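(* The B-Z constant of the family $\mathcal{P}_2=\{P_n^2 : n\ge 4\}$ of squares of paths exists and equals $$BZ(\mathcal{P}_2)=\lim_{n\to\infty}\frac{\sum_{T\in\mathcal{T}(P_n^2)}|\mathcal{L}(T)|}{n\cdot\tau(P_n^2)}=-6+\frac{14\sqrt{5}}{5}.$$
   Context: All graphs are finite and simple. $P_n$ is the path graph on $n$ vertices. For a graph $G$ and $k\ge1$, the $k$-th power $G^k$ has $V(G^k)=V(G)$, and $uv$ is an edge iff the distance between $u$ and $v$ in $G$ is at least $1$ and at most $k$. $\mathcal{T}(G)$ is the set of labeled spanning trees of $G$, $\tau(G)=|\mathcal{T}(G)|$, and $\mathcal{L}(T)$ is the set of leaves (vertices of degree exactly $1$ in $T$) of a tree $T$. For a graph family $\mathcal{G}$ indexed by number of vertices, with $G_n$ the member on $n$ vertices, the B-Z constant is $BZ(\mathcal{G}):=\lim_{n\to\infty}\frac{\sum_{T\in\mathcal{T}(G_n)}|\mathcal{L}(T)|}{n\,\tau(G_n)}$ whenever the limit exists. *)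

theory Defs
  imports Complex_Main "HOL-Library.Extended_Nat"
begin

record 'a sgraph =
  sverts :: "'a set"
  sedges :: "'a set set"

definition finite_simple_graph :: "'a sgraph \<Rightarrow> bool" where
  "finite_simple_graph G \<longleftrightarrow>
     finite (sverts G) \<and> (\<forall>e\<in>sedges G. e \<subseteq> sverts G \<and> card e = 2)"

text \<open>A walk is the nonempty list of its vertices; its length is the number of edges,
  \<open>length p - 1\<close>.\<close>

definition walk_between :: "'a sgraph \<Rightarrow> 'a \<Rightarrow> 'a list \<Rightarrow> 'a \<Rightarrow> bool" where
  "walk_between G u p v \<longleftrightarrow>
     p \<noteq> [] \<and> hd p = u \<and> last p = v \<and> set p \<subseteq> sverts G \<and>
     successively (\<lambda>x y. {x, y} \<in> sedges G) p"

text \<open>The distance is \<open>\<infinity>\<close> if no walk joins the two vertices.\<close>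

definition graph_dist :: "'a sgraph \<Rightarrow> 'a \<Rightarrow> 'a \<Rightarrow> enat" where
  "graph_dist G u v = (INF p \<in> {p. walk_between G u p v}. enat (length p - 1))"

definition graph_power :: "'a sgraph \<Rightarrow> nat \<Rightarrow> 'a sgraph" where
  "graph_power G k =
     \<lparr>sverts = sverts G,
      sedges = {{u, v} | u v. u \<in> sverts G \<and> v \<in> sverts G \<and>
                              1 \<le> graph_dist G u v \<and> graph_dist G u v \<le> enat k}\<rparr>"

definition path_graph :: "nat \<Rightarrow> nat sgraph" where
  "path_graph n = \<lparr>sverts = {..<n}, sedges = {{i, Suc i} | i. Suc i < n}\<rparr>"

definition connected_graph :: "'a sgraph \<Rightarrow> bool" where
  "connected_graph G \<longleftrightarrow>
     sverts G \<noteq> {} \<and> (\<forall>u\<in>sverts G. \<forall>v\<in>sverts G. \<exists>p. walk_between G u p v)"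

text \<open>A cycle is the list of its distinct vertices; the closing edge joins the last vertex
  to the first.\<close>

definition graph_cycle :: "'a sgraph \<Rightarrow> 'a list \<Rightarrow> bool" where
  "graph_cycle G c \<longleftrightarrow>
     3 \<le> length c \<and> distinct c \<and> set c \<subseteq> sverts G \<and>
     successively (\<lambda>x y. {x, y} \<in> sedges G) c \<and> {last c, hd c} \<in> sedges G"

definition tree_graph :: "'a sgraph \<Rightarrow> bool" where
  "tree_graph T \<longleftrightarrow>
     finite_simple_graph T \<and> connected_graph T \<and> \<not> (\<exists>c. graph_cycle T c)"

text \<open>Spanning trees are labeled: they are counted as subgraphs, not up to isomorphism.\<close>

definition spanning_trees :: "'a sgraph \<Rightarrow> 'a sgraph set" where
  "spanning_trees G =
     {T. tree_graph T \<and> sverts T = sverts G \<and> sedges T \<subseteq> sedges G}"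

definition num_spanning_trees :: "'a sgraph \<Rightarrow> nat" where
  "num_spanning_trees G = card (spanning_trees G)"

definition vertex_degree :: "'a sgraph \<Rightarrow> 'a \<Rightarrow> nat" where
  "vertex_degree G v = card {e \<in> sedges G. v \<in> e}"

definition graph_leaves :: "'a sgraph \<Rightarrow> 'a set" where
  "graph_leaves T = {v \<in> sverts T. vertex_degree T v = 1}"

text \<open>A graph family is given by its member \<open>\<G> n\<close> on \<open>n\<close> vertices. Only large \<open>n\<close>
  matter for the limit, so a family that starts at some \<open>n\<^sub>0\<close> may take any values
  below \<open>n\<^sub>0\<close>.\<close>

definition BZ_ratio :: "(nat \<Rightarrow> 'a sgraph) \<Rightarrow> nat \<Rightarrow> real" where
  "BZ_ratio \<G> n =
     real (\<Sum>T\<in>spanning_trees (\<G> n). card (graph_leaves T)) /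
     (real n * real (num_spanning_trees (\<G> n)))"

text \<open>Meaningful only if \<open>convergent (BZ_ratio \<G>)\<close>, as \<^const>\<open>lim\<close> is total.\<close>

definition BZ :: "(nat \<Rightarrow> 'a sgraph) \<Rightarrow> real" where
  "BZ \<G> = lim (BZ_ratio \<G>)"

definition path_squares :: "nat \<Rightarrow> nat sgraph" where
  "path_squares n = graph_power (path_graph n) 2"

end

theory Submission
  imports Defs "HOL-Number_Theory.Fib"
begin

text \<open>
  A tree in which \<open>v\<close> is a leaf is a spanning tree of \<open>G - v\<close> together with one of the edges
  at \<open>v\<close>. Summing over \<open>v\<close> gives, for every graph,
  \<open>\<Sum>\<^sub>T |\<L>(T)| = \<Sum>\<^sub>v deg v * \<tau>(G - v)\<close> (lemma \<open>sum_leaves_over_trees\<close>). For the square of a path,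
  \<open>G - v\<close> is again explicit: the only edge that jumps over \<open>v\<close> is the bridge \<open>{v - 1, v + 1}\<close>,
  so \<open>\<tau>(G - v)\<close> is the product of the numbers of spanning trees of the two shorter squares on
  either side of \<open>v\<close>.

  The numbers themselves come from a recurrence at the last vertex \<open>z\<close>, whose two neighbours
  \<open>x\<close> and \<open>y\<close> are adjacent. In a spanning tree \<open>z\<close> is either a leaf or the middle of a path
  \<open>x z y\<close>, which can be shortened to the edge \<open>x y\<close>. So, with \<open>\<sigma>\<close> the number of trees through
  the edge of the last two vertices, \<open>\<tau>' = 2 \<tau> + \<sigma>\<close> and \<open>\<sigma>' = \<tau> + \<sigma>\<close> (lemma
  \<open>card_trees_triangle_tip\<close>). These are two Fibonacci steps, hence \<open>\<tau>(P\<^sub>n\<^sup>2) = F\<^bsub>2n-2\<^esub>\<close> for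
  \<open>n \<ge> 2\<close>. The recurrence sees only the end of the vertex set, so the same induction also proves
  the product formula for \<open>G - v\<close>, with the part to the left of \<open>v\<close> as its starting point
  (lemma \<open>card_square_trees_append_block\<close>).

  Almost all vertices have degree 4, so up to boundary terms of order \<open>\<tau>(P\<^sub>n\<^sup>2)\<close> the number of
  leaves is 4 times a convolution of even-indexed Fibonacci numbers. With
  \<open>\<alpha> = (3 + sqrt 5) / 2\<close>, the square of the golden ratio, \<open>F\<^bsub>2m\<^esub>\<close> behaves like \<open>\<alpha>\<^sup>m / sqrt 5\<close>, so all
  of the about \<open>n\<close> summands except those near the ends are, divided by \<open>\<tau>(P\<^sub>n\<^sup>2)\<close>, close to
  \<open>1 / (sqrt 5 \<alpha>\<^sup>2)\<close>. Hence the limit is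
  \<open>4 / (sqrt 5 \<alpha>\<^sup>2) = - 6 + 14 sqrt 5 / 5\<close>.

  Throughout, trees are handled as edge sets that connect the vertices but stop doing so when
  any edge is dropped; for these the two bijections above reduce to statements about connectivity
  alone.
\<close>

section \<open>Minimally connecting edge sets\<close>

definition adjacency :: "'a set set \<Rightarrow> ('a \<times> 'a) set" where
  "adjacency E = {(x, y). {x, y} \<in> E}"

definition connects :: "'a set set \<Rightarrow> 'a set \<Rightarrow> bool" where
  "connects E V \<longleftrightarrow> (\<forall>u\<in>V. \<forall>w\<in>V. (u, w) \<in> (adjacency E)\<^sup>*)"

definition minimally_connects :: "'a set set \<Rightarrow> 'a set \<Rightarrow> bool" where
  "minimally_connects E V \<longleftrightarrow> connects E V \<and> (\<forall>e\<in>E. \<not> connects (E - {e}) V)"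

definition simple_edges :: "'a set \<Rightarrow> 'a set set \<Rightarrow> bool" where
  "simple_edges V F \<longleftrightarrow> (\<forall>e\<in>F. e \<subseteq> V \<and> card e = 2)"

definition spanning_edge_sets :: "'a set \<Rightarrow> 'a set set \<Rightarrow> 'a set set set" where
  "spanning_edge_sets V F = {E. E \<subseteq> F \<and> minimally_connects E V}"

definition edges_avoiding :: "'a \<Rightarrow> 'a set set \<Rightarrow> 'a set set" where
  "edges_avoiding v F = {e \<in> F. v \<notin> e}"

lemma sym_adjacency: "sym (adjacency E)"
  by (auto simp: sym_def adjacency_def insert_commute)

lemma reach_sym: "(x, y) \<in> (adjacency E)\<^sup>* \<Longrightarrow> (y, x) \<in> (adjacency E)\<^sup>*"
  using sym_rtrancl[OF sym_adjacency] by (rule symD)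

lemma reach_mono: "(x, y) \<in> (adjacency E)\<^sup>* \<Longrightarrow> E \<subseteq> E' \<Longrightarrow> (x, y) \<in> (adjacency E')\<^sup>*"
  using rtrancl_mono[of "adjacency E" "adjacency E'"] by (auto simp: adjacency_def)

lemma edge_reach: "{x, y} \<in> E \<Longrightarrow> (x, y) \<in> (adjacency E)\<^sup>*"
  by (auto simp: adjacency_def)

lemma connects_iff_reach_root:
  assumes "x \<in> V"
  shows "connects E V \<longleftrightarrow> (\<forall>u\<in>V. (u, x) \<in> (adjacency E)\<^sup>*)"
  using assms unfolding connects_def by (meson reach_sym rtrancl_trans)

text \<open>A map that sends every edge to a pair of connected vertices sends walks to walks. The main use
  is the map that collapses a removed vertex onto one of its neighbours.\<close>

lemma reach_map:
  assumes "\<And>a b. {a, b} \<in> E \<Longrightarrow> (f a, f b) \<in> (adjacency E')\<^sup>*"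
    and "(u, w) \<in> (adjacency E)\<^sup>*"
  shows "(f u, f w) \<in> (adjacency E')\<^sup>*"
  using assms(2)
proof induction
  case (step y z)
  then have "{y, z} \<in> E" by (simp add: adjacency_def)
  with step assms(1) show ?case by (meson rtrancl_trans)
qed simp

lemma connects_simulate:
  assumes "\<And>a b. {a, b} \<in> E \<Longrightarrow> (a, b) \<in> (adjacency E')\<^sup>*" "connects E V"
  shows "connects E' V"
  using reach_map[of E "\<lambda>x. x" E'] assms unfolding connects_def by blast

text \<open>Collapsing the leaf \<open>v\<close> onto \<open>x\<close> turns its edge into a loop and leaves all other edges alone,
  so no detour through \<open>v\<close> is needed to connect vertices of \<open>V\<close>.\<close>

lemma connects_add_leaf:
  assumes "v \<notin> V" "x \<in> V" "\<And>e. e \<in> E \<Longrightarrow> e \<subseteq> V"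
  shows "connects (insert {v, x} E) (insert v V) \<longleftrightarrow> connects E V"
proof
  assume L: "connects (insert {v, x} E) (insert v V)"
  let ?f = "\<lambda>u. if u = v then x else u"
  have *: "(?f a, ?f b) \<in> (adjacency E)\<^sup>*" if "{a, b} \<in> insert {v, x} E" for a b
  proof (cases "{a, b} = {v, x}")
    case True
    then show ?thesis by (auto simp: doubleton_eq_iff)
  next
    case False
    with that have e: "{a, b} \<in> E" by blast
    with assms(1,3) have "a \<noteq> v" "b \<noteq> v" by blast+
    with edge_reach[OF e] show ?thesis by simp
  qed
  show "connects E V"
    unfolding connects_def
  proof (intro ballI)
    fix u w assume "u \<in> V" "w \<in> V"
    with L have "(u, w) \<in> (adjacency (insert {v, x} E))\<^sup>*" by (simp add: connects_def)
    from reach_map[where f = ?f, OF * this] \<open>u \<in> V\<close> \<open>w \<in> V\<close> assms(1)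
    show "(u, w) \<in> (adjacency E)\<^sup>*" by (auto split: if_splits)
  qed
next
  assume "connects E V"
  then have "\<And>u. u \<in> V \<Longrightarrow> (u, x) \<in> (adjacency E)\<^sup>*" using assms(2) by (simp add: connects_def)
  then have "\<And>u. u \<in> V \<Longrightarrow> (u, x) \<in> (adjacency (insert {v, x} E))\<^sup>*"
    using reach_mono by (metis subset_insertI)
  moreover have "(v, x) \<in> (adjacency (insert {v, x} E))\<^sup>*" by (rule edge_reach) simp
  ultimately show "connects (insert {v, x} E) (insert v V)"
    using assms(2) by (subst connects_iff_reach_root[of x]) auto
qed

text \<open>Collapsing \<open>v\<close> onto \<open>x\<close> turns the path \<open>x v y\<close> into the edge \<open>x y\<close>; conversely that edge can be
  replaced by the path.\<close>

lemma connects_subdivide: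
  assumes "v \<notin> V" "x \<in> V" "y \<in> V" "\<And>e. e \<in> E \<Longrightarrow> e \<subseteq> V"
  shows "connects (insert {v, x} (insert {v, y} E)) (insert v V) \<longleftrightarrow> connects (insert {x, y} E) V"
    (is "connects ?E2 _ \<longleftrightarrow> connects ?E1 _")
proof
  assume L: "connects ?E2 (insert v V)"
  let ?f = "\<lambda>u. if u = v then x else u"
  have xy: "(x, y) \<in> (adjacency ?E1)\<^sup>*" by (rule edge_reach) simp
  have *: "(?f a, ?f b) \<in> (adjacency ?E1)\<^sup>*" if "{a, b} \<in> ?E2" for a b
  proof (cases "{a, b} \<in> E")
    case True
    with assms(1,4) have "a \<noteq> v" "b \<noteq> v" by blast+
    with True show ?thesis by (auto intro: edge_reach)
  next
    case False
    with that have "{a, b} = {v, x} \<or> {a, b} = {v, y}" by blast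
    then show ?thesis using xy reach_sym[OF xy] by (auto simp: doubleton_eq_iff)
  qed
  show "connects ?E1 V"
    unfolding connects_def
  proof (intro ballI)
    fix u w assume "u \<in> V" "w \<in> V"
    with L have "(u, w) \<in> (adjacency ?E2)\<^sup>*" by (simp add: connects_def)
    from reach_map[where f = ?f, OF * this] \<open>u \<in> V\<close> \<open>w \<in> V\<close> assms(1)
    show "(u, w) \<in> (adjacency ?E1)\<^sup>*" by (auto split: if_splits)
  qed
next
  assume L: "connects ?E1 V"
  have vx: "(v, x) \<in> (adjacency ?E2)\<^sup>*" and vy: "(v, y) \<in> (adjacency ?E2)\<^sup>*"
    by (rule edge_reach, simp)+
  have xy: "(x, y) \<in> (adjacency ?E2)\<^sup>*" using reach_sym[OF vx] vy by (rule rtrancl_trans)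
  have "connects ?E2 V"
  proof (rule connects_simulate[OF _ L])
    fix a b assume "{a, b} \<in> ?E1"
    then show "(a, b) \<in> (adjacency ?E2)\<^sup>*"
      using xy reach_sym[OF xy] by (auto simp: doubleton_eq_iff intro: edge_reach)
  qed
  with vx assms(2) show "connects ?E2 (insert v V)"
    by (subst connects_iff_reach_root[of x]) (auto simp: connects_iff_reach_root)
qed

lemma isolated_not_connects:
  assumes "v \<notin> V" "x \<in> V" "\<And>e. e \<in> E \<Longrightarrow> e \<subseteq> V"
  shows "\<not> connects E (insert v V)"
proof
  assume "connects E (insert v V)"
  then have "(v, x) \<in> (adjacency E)\<^sup>*" using assms(2) by (simp add: connects_def)
  then show False
  proof (cases rule: converse_rtranclE)
    case base
    then show ?thesis using assms by simp
  next
    case (step z)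
    then show ?thesis using assms by (auto simp: adjacency_def)
  qed
qed

text \<open>Minimality is inherited because \<open>connects_add_leaf\<close> also applies after an old edge has been
  dropped, while dropping the new edge isolates \<open>v\<close>.\<close>

lemma minimally_connects_add_leaf:
  assumes "v \<notin> V" "x \<in> V" "\<And>e. e \<in> E \<Longrightarrow> e \<subseteq> V"
  shows "minimally_connects (insert {v, x} E) (insert v V) \<longleftrightarrow> minimally_connects E V"
proof -
  have new: "{v, x} \<notin> E" using assms by blast
  have "connects (insert {v, x} E - {e}) (insert v V) \<longleftrightarrow> connects (E - {e}) V" if "e \<in> E" for e
  proof -
    have "insert {v, x} E - {e} = insert {v, x} (E - {e})" using new that by blast
    then show ?thesis using connects_add_leaf[of v V x "E - {e}"] assms by auto
  qed
  moreover have "\<not> connects (insert {v, x} E - {{v, x}}) (insert v V)"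
    using isolated_not_connects[of v V x E] assms new by simp
  ultimately show ?thesis
    unfolding minimally_connects_def using connects_add_leaf[OF assms] by simp
qed

text \<open>Dropping an old edge is covered by \<open>connects_subdivide\<close>. Dropping one half of the path \<open>x v y\<close>
  leaves \<open>v\<close> as a leaf on the other half, which corresponds to dropping \<open>x y\<close> itself.\<close>

lemma minimally_connects_subdivide:
  assumes "v \<notin> V" "x \<in> V" "y \<in> V" "x \<noteq> y" "{x, y} \<notin> E" "\<And>e. e \<in> E \<Longrightarrow> e \<subseteq> V"
  shows "minimally_connects (insert {v, x} (insert {v, y} E)) (insert v V) \<longleftrightarrow>
         minimally_connects (insert {x, y} E) V"
proof -
  have new: "{v, x} \<notin> E" "{v, y} \<notin> E" using assms by blast+
  have ne: "{v, x} \<noteq> {v, y}" using assms by (auto simp: doubleton_eq_iff)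
  have "connects (insert {v, x} (insert {v, y} E) - {e}) (insert v V) \<longleftrightarrow>
        connects (insert {x, y} E - {e}) V" if "e \<in> E" for e
  proof -
    have "insert {v, x} (insert {v, y} E) - {e} = insert {v, x} (insert {v, y} (E - {e}))"
      "insert {x, y} E - {e} = insert {x, y} (E - {e})"
      using new assms(5) that by blast+
    then show ?thesis using connects_subdivide[of v V x y "E - {e}"] assms by auto
  qed
  moreover have "insert {v, x} (insert {v, y} E) - {{v, x}} = insert {v, y} E"
    "insert {v, x} (insert {v, y} E) - {{v, y}} = insert {v, x} E"
    "insert {x, y} E - {{x, y}} = E"
    using new ne assms(5) by blast+
  ultimately show ?thesis
    unfolding minimally_connects_def
    using connects_subdivide[of v V x y E] connects_add_leaf[of v V x E]
      connects_add_leaf[of v V y E] assms by auto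
qed

text \<open>The third side of a triangle could be dropped, as the other two sides still connect its ends.\<close>

lemma minimally_connects_no_triangle:
  assumes "minimally_connects E V" "{v, x} \<in> E" "{v, y} \<in> E" "x \<noteq> v" "y \<noteq> v"
  shows "{x, y} \<notin> E"
proof
  assume e: "{x, y} \<in> E"
  have "{v, x} \<in> E - {{x, y}}" "{v, y} \<in> E - {{x, y}}"
    using assms by (auto simp: doubleton_eq_iff)
  then have xy: "(x, y) \<in> (adjacency (E - {{x, y}}))\<^sup>*"
    by (meson edge_reach reach_sym rtrancl_trans)
  have "connects (E - {{x, y}}) V"
  proof (rule connects_simulate[of E])
    fix a b assume "{a, b} \<in> E"
    then show "(a, b) \<in> (adjacency (E - {{x, y}}))\<^sup>*"
      using xy reach_sym[OF xy] edge_reach[of a b "E - {{x, y}}"]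
      by (cases "{a, b} = {x, y}") (auto simp: doubleton_eq_iff)
  qed (use assms in \<open>simp add: minimally_connects_def\<close>)
  then show False using assms(1) e by (simp add: minimally_connects_def)
qed

section \<open>Counting trees by the edges at a vertex\<close>

lemma simple_edges_incident:
  assumes "simple_edges V F" "e \<in> F" "v \<in> e"
  obtains x where "e = {v, x}" "x \<noteq> v" "x \<in> V"
proof -
  from assms obtain a b where "e = {a, b}" "a \<noteq> b"
    unfolding simple_edges_def by (metis card_2_iff)
  with assms have "e = {v, if a = v then b else a}" "(if a = v then b else a) \<noteq> v"
    "(if a = v then b else a) \<in> V"
    unfolding simple_edges_def by auto
  then show thesis by (rule that)
qed

lemma finite_simple_edges: "finite V \<Longrightarrow> simple_edges V F \<Longrightarrow> finite F"
  by (rule finite_subset[of _ "Pow V"]) (auto simp: simple_edges_def)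

lemma finite_spanning_edge_sets:
  "finite V \<Longrightarrow> simple_edges V F \<Longrightarrow> finite (spanning_edge_sets V F)"
  by (rule finite_subset[of _ "Pow F"]) (auto simp: spanning_edge_sets_def finite_simple_edges)

lemma avoiding_subset: "simple_edges V F \<Longrightarrow> e \<in> edges_avoiding v F \<Longrightarrow> e \<subseteq> V - {v}"
  by (auto simp: simple_edges_def edges_avoiding_def)

lemma card_trees_with_leaf_edge:
  assumes F: "simple_edges V F" and v: "v \<in> V" and x: "{v, x} \<in> F"
  shows "card {E \<in> spanning_edge_sets V F. {e \<in> E. v \<in> e} = {{v, x}}} =
         card (spanning_edge_sets (V - {v}) (edges_avoiding v F))" (is "card ?A = card ?B")
proof -
  have xV: "x \<in> V - {v}"
    using F x by (auto simp: simple_edges_def)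
  have add: "minimally_connects (insert {v, x} E) V \<longleftrightarrow> minimally_connects E (V - {v})"
    if "E \<subseteq> edges_avoiding v F" for E
    using minimally_connects_add_leaf[of v "V - {v}" x E] that xV avoiding_subset[OF F] v
    by (auto simp: insert_absorb)
  have inj: "inj_on (insert {v, x}) ?B"
  proof (rule inj_onI)
    fix E E' assume "E \<in> ?B" "E' \<in> ?B" "insert {v, x} E = insert {v, x} E'"
    moreover from this have "{v, x} \<notin> E" "{v, x} \<notin> E'"
      by (auto simp: spanning_edge_sets_def edges_avoiding_def)
    ultimately show "E = E'" by (simp add: insert_ident)
  qed
  have "insert {v, x} ` ?B = ?A"
  proof (intro equalityI subsetI)
    fix E assume "E \<in> insert {v, x} ` ?B"
    then obtain E' where E': "E = insert {v, x} E'" "E' \<in> ?B" by blast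
    then have "E' \<subseteq> edges_avoiding v F" by (simp add: spanning_edge_sets_def)
    with E' add x show "E \<in> ?A" by (auto simp: spanning_edge_sets_def edges_avoiding_def)
  next
    fix E assume E: "E \<in> ?A"
    let ?E' = "{e \<in> E. v \<notin> e}"
    have eq: "E = insert {v, x} ?E'" using E by blast
    have sub: "?E' \<subseteq> edges_avoiding v F"
      using E by (auto simp: spanning_edge_sets_def edges_avoiding_def)
    have "minimally_connects (insert {v, x} ?E') V"
      using E eq by (simp add: spanning_edge_sets_def)
    then have "?E' \<in> ?B" using add[OF sub] sub by (simp add: spanning_edge_sets_def)
    with eq show "E \<in> insert {v, x} ` ?B" by blast
  qed
  then show ?thesis using card_image[OF inj] by simp
qed

text \<open>The bijection shortens the path \<open>x v y\<close> to the edge \<open>x y\<close>. That edge is not already present,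
  as a tree contains no triangle.\<close>

lemma card_trees_with_suppressible_vertex:
  assumes F: "simple_edges V F" and v: "v \<in> V"
    and x: "{v, x} \<in> F" and y: "{v, y} \<in> F" and xy: "{x, y} \<in> F"
  shows "card {E \<in> spanning_edge_sets V F. {e \<in> E. v \<in> e} = {{v, x}, {v, y}}} =
         card {E \<in> spanning_edge_sets (V - {v}) (edges_avoiding v F). {x, y} \<in> E}"
    (is "card ?A = card ?B")
proof -
  have V: "x \<in> V - {v}" "y \<in> V - {v}" "x \<noteq> y"
    using F x y xy by (auto simp: simple_edges_def)
  let ?f = "\<lambda>E. insert {v, x} (insert {v, y} (E - {{x, y}}))"
  have xy': "{x, y} \<in> edges_avoiding v F" using xy V by (auto simp: edges_avoiding_def)
  have sub: "minimally_connects (?f E) V \<longleftrightarrow> minimally_connects E (V - {v})"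
    if "E \<subseteq> edges_avoiding v F" "{x, y} \<in> E" for E
    using minimally_connects_subdivide[of v "V - {v}" x y "E - {{x, y}}"]
      that V avoiding_subset[OF F] v
    by (auto simp: insert_absorb)
  have inj: "inj_on ?f ?B"
  proof (rule inj_onI)
    fix E E' assume "E \<in> ?B" "E' \<in> ?B" and eq: "?f E = ?f E'"
    then have "\<And>e. e \<in> E \<union> E' \<Longrightarrow> v \<notin> e" "{x, y} \<in> E" "{x, y} \<in> E'"
      by (auto simp: spanning_edge_sets_def edges_avoiding_def)
    then have "E = insert {x, y} {e \<in> ?f E. v \<notin> e}" "E' = insert {x, y} {e \<in> ?f E'. v \<notin> e}"
      by auto
    with eq show "E = E'" by metis
  qed
  have "?f ` ?B = ?A"
  proof (intro equalityI subsetI)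
    fix E assume "E \<in> ?f ` ?B"
    then obtain E' where E': "E = ?f E'" "E' \<in> ?B" by blast
    then have s: "E' \<subseteq> edges_avoiding v F" "{x, y} \<in> E'" by (auto simp: spanning_edge_sets_def)
    have "E \<subseteq> F" using E'(1) s(1) x y by (auto simp: edges_avoiding_def)
    moreover have "minimally_connects E V"
      using sub[OF s] E' by (simp add: spanning_edge_sets_def)
    moreover have "{e \<in> E. v \<in> e} = {{v, x}, {v, y}}"
      using E'(1) s(1) by (auto simp: edges_avoiding_def)
    ultimately show "E \<in> ?A" by (simp add: spanning_edge_sets_def)
  next
    fix E assume E: "E \<in> ?A"
    let ?E' = "insert {x, y} {e \<in> E. v \<notin> e}"
    have mc: "minimally_connects E V" and inc: "{e \<in> E. v \<in> e} = {{v, x}, {v, y}}"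
      using E by (auto simp: spanning_edge_sets_def)
    have "{x, y} \<notin> E"
      using minimally_connects_no_triangle[OF mc, of v x y] inc V by blast
    then have eq: "E = ?f ?E'" using inc by blast
    have s: "?E' \<subseteq> edges_avoiding v F"
      using E xy' by (auto simp: spanning_edge_sets_def edges_avoiding_def)
    have "minimally_connects ?E' (V - {v})" using sub[OF s] eq mc by simp
    then have "?E' \<in> ?B" using s by (simp add: spanning_edge_sets_def)
    with eq show "E \<in> ?f ` ?B" by blast
  qed
  then show ?thesis using card_image[OF inj] by simp
qed

lemma tree_covers_vertex:
  assumes F: "simple_edges V F" and E: "E \<in> spanning_edge_sets V F"
    and v: "v \<in> V" "V - {v} \<noteq> {}"
  shows "{e \<in> E. v \<in> e} \<noteq> {}"
proof
  assume none: "{e \<in> E. v \<in> e} = {}"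
  from v obtain x where x: "x \<in> V - {v}" by blast
  have "e \<subseteq> V - {v}" if "e \<in> E" for e
    using that none E F by (auto simp: spanning_edge_sets_def simple_edges_def)
  from isolated_not_connects[of v, OF _ x this] have "\<not> connects E V"
    using v by (simp add: insert_absorb)
  then show False using E by (simp add: spanning_edge_sets_def minimally_connects_def)
qed

lemma card_trees_with_leaf:
  assumes fin: "finite V" and F: "simple_edges V F" and v: "v \<in> V"
  shows "card {E \<in> spanning_edge_sets V F. card {e \<in> E. v \<in> e} = 1} =
         card {x. {v, x} \<in> F} * card (spanning_edge_sets (V - {v}) (edges_avoiding v F))"
proof -
  let ?N = "{x. {v, x} \<in> F}"
  let ?A = "\<lambda>x. {E \<in> spanning_edge_sets V F. {e \<in> E. v \<in> e} = {{v, x}}}"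
  have N: "finite ?N"
    by (rule finite_subset[OF _ fin]) (use F in \<open>auto simp: simple_edges_def\<close>)
  have "{E \<in> spanning_edge_sets V F. card {e \<in> E. v \<in> e} = 1} = (\<Union>x\<in>?N. ?A x)"
  proof (intro equalityI subsetI)
    fix E assume E: "E \<in> {E \<in> spanning_edge_sets V F. card {e \<in> E. v \<in> e} = 1}"
    then obtain e where e: "{e \<in> E. v \<in> e} = {e}" by (auto simp: card_1_singleton_iff)
    then have "e \<in> F" "v \<in> e" using E by (auto simp: spanning_edge_sets_def)
    then obtain x where "e = {v, x}" using simple_edges_incident[OF F] by metis
    with e E \<open>e \<in> F\<close> show "E \<in> (\<Union>x\<in>?N. ?A x)" by auto
  next
    fix E assume "E \<in> (\<Union>x\<in>?N. ?A x)"
    then obtain x where "E \<in> spanning_edge_sets V F" and I: "{e \<in> E. v \<in> e} = {{v, x}}" by blast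
    moreover have "card {e \<in> E. v \<in> e} = 1" unfolding I by simp
    ultimately show "E \<in> {E \<in> spanning_edge_sets V F. card {e \<in> E. v \<in> e} = 1}" by blast
  qed
  moreover have "card (\<Union>x\<in>?N. ?A x) = (\<Sum>x\<in>?N. card (?A x))"
  proof (rule card_UN_disjoint[OF N])
    show "\<forall>x\<in>?N. finite (?A x)" using finite_spanning_edge_sets[OF fin F] by simp
    show "\<forall>x\<in>?N. \<forall>y\<in>?N. x \<noteq> y \<longrightarrow> ?A x \<inter> ?A y = {}"
    proof (intro ballI impI)
      fix x y :: 'a assume "x \<noteq> y"
      then have ne: "{{v, x}} \<noteq> {{v, y}}" by (auto simp: doubleton_eq_iff)
      show "?A x \<inter> ?A y = {}"
      proof (rule ccontr)
        assume "?A x \<inter> ?A y \<noteq> {}"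
        then obtain E where "{e \<in> E. v \<in> e} = {{v, x}}" "{e \<in> E. v \<in> e} = {{v, y}}" by blast
        with ne show False by metis
      qed
    qed
  qed
  moreover have "(\<Sum>x\<in>?N. card (?A x)) =
      (\<Sum>x\<in>?N. card (spanning_edge_sets (V - {v}) (edges_avoiding v F)))"
    by (rule sum.cong) (simp_all add: card_trees_with_leaf_edge[OF F v])
  ultimately show ?thesis by simp
qed

text \<open>Double counting of the pairs of a tree and one of its leaves; \<open>card {x. {v, x} \<in> F}\<close> is the
  degree of \<open>v\<close>.\<close>

lemma sum_leaves_over_trees:
  assumes fin: "finite V" and F: "simple_edges V F"
  shows "(\<Sum>E\<in>spanning_edge_sets V F. card {v \<in> V. card {e \<in> E. v \<in> e} = 1}) =
         (\<Sum>v\<in>V. card {x. {v, x} \<in> F} *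
            card (spanning_edge_sets (V - {v}) (edges_avoiding v F)))"
proof -
  have ind: "card {a \<in> A. P a} = (\<Sum>a\<in>A. if P a then 1 else 0)" if "finite A" for A :: "'x set" and P
    using that by (simp add: sum.If_cases Int_def)
  have "(\<Sum>E\<in>spanning_edge_sets V F. card {v \<in> V. card {e \<in> E. v \<in> e} = 1}) =
        (\<Sum>v\<in>V. card {E \<in> spanning_edge_sets V F. card {e \<in> E. v \<in> e} = 1})"
    unfolding ind[OF fin] ind[OF finite_spanning_edge_sets[OF fin F]] by (rule sum.swap)
  also have "\<dots> = (\<Sum>v\<in>V. card {x. {v, x} \<in> F} *
            card (spanning_edge_sets (V - {v}) (edges_avoiding v F)))"
    by (rule sum.cong[OF refl]) (rule card_trees_with_leaf[OF fin F])
  finally show ?thesis .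
qed

lemma card_trees_pendant:
  assumes F: "simple_edges V F" and v: "v \<in> V" and inc: "{e \<in> F. v \<in> e} = {{v, x}}"
  shows "card (spanning_edge_sets V F) = card (spanning_edge_sets (V - {v}) (edges_avoiding v F))"
    and "{E \<in> spanning_edge_sets V F. {v, x} \<in> E} = spanning_edge_sets V F"
proof -
  have vx: "{v, x} \<in> F" using inc by blast
  then have "x \<in> V - {v}" using F by (auto simp: simple_edges_def)
  then have "V - {v} \<noteq> {}" by blast
  have *: "{e \<in> E. v \<in> e} = {{v, x}}" if "E \<in> spanning_edge_sets V F" for E
  proof -
    have "{e \<in> E. v \<in> e} \<subseteq> {e \<in> F. v \<in> e}" using that by (auto simp: spanning_edge_sets_def)
    with tree_covers_vertex[OF F that v \<open>V - {v} \<noteq> {}\<close>] show ?thesis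
      unfolding inc by (metis subset_singletonD)
  qed
  then have "{E \<in> spanning_edge_sets V F. {e \<in> E. v \<in> e} = {{v, x}}} = spanning_edge_sets V F"
    by blast
  with card_trees_with_leaf_edge[OF F v vx]
  show "card (spanning_edge_sets V F) = card (spanning_edge_sets (V - {v}) (edges_avoiding v F))"
    by simp
  show "{E \<in> spanning_edge_sets V F. {v, x} \<in> E} = spanning_edge_sets V F"
    using * by blast
qed

text \<open>The tree uses \<open>v x\<close> alone, \<open>v y\<close> alone, or both edges at \<open>v\<close>; in the last case \<open>v\<close> is suppressed.
  The trees through \<open>v y\<close> are counted along with all trees, since the edge \<open>y v\<close> plays the role of
  \<open>x y\<close> when the next vertex is attached.\<close>

lemma card_trees_triangle_tip:
  assumes fin: "finite V" and F: "simple_edges V F" and v: "v \<in> V"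
    and inc: "{e \<in> F. v \<in> e} = {{v, x}, {v, y}}" and xy: "{x, y} \<in> F"
  defines "\<T> \<equiv> spanning_edge_sets (V - {v}) (edges_avoiding v F)"
  shows "card (spanning_edge_sets V F) = 2 * card \<T> + card {E \<in> \<T>. {x, y} \<in> E}"
    and "card {E \<in> spanning_edge_sets V F. {v, y} \<in> E} = card \<T> + card {E \<in> \<T>. {x, y} \<in> E}"
proof -
  let ?S = "spanning_edge_sets V F"
  let ?A = "\<lambda>I. {E \<in> ?S. {e \<in> E. v \<in> e} = I}"
  have x: "{v, x} \<in> F" and y: "{v, y} \<in> F" using inc by blast+
  have ne: "x \<noteq> y" and xV: "x \<in> V - {v}" and "y \<noteq> v"
    using F x y xy by (auto simp: simple_edges_def)
  then have ne': "{v, x} \<noteq> {v, y}" by (auto simp: doubleton_eq_iff)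
  from xV have "V - {v} \<noteq> {}" by blast
  have two: "A = {a} \<or> A = {b} \<or> A = {a, b}" if "A \<noteq> {}" "A \<subseteq> {a, b}" for A and a b :: "'a set"
    using that by blast
  have cases: "{e \<in> E. v \<in> e} = {{v, x}} \<or> {e \<in> E. v \<in> e} = {{v, y}} \<or>
      {e \<in> E. v \<in> e} = {{v, x}, {v, y}}" if "E \<in> ?S" for E
  proof -
    have "{e \<in> E. v \<in> e} \<subseteq> {e \<in> F. v \<in> e}" using that by (auto simp: spanning_edge_sets_def)
    from tree_covers_vertex[OF F that v \<open>V - {v} \<noteq> {}\<close>] this[unfolded inc] show ?thesis
      by (rule two)
  qed
  have finA: "finite (?A I)" for I using finite_spanning_edge_sets[OF fin F] by simp
  have cx: "card (?A {{v, x}}) = card \<T>" and cy: "card (?A {{v, y}}) = card \<T>"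
    and cxy: "card (?A {{v, x}, {v, y}}) = card {E \<in> \<T>. {x, y} \<in> E}"
    using card_trees_with_leaf_edge[OF F v x] card_trees_with_leaf_edge[OF F v y]
      card_trees_with_suppressible_vertex[OF F v x y xy] by (simp_all add: \<T>_def)
  have disj: "?A I \<inter> ?A J = {}" if "I \<noteq> J" for I J
  proof (rule ccontr)
    assume "?A I \<inter> ?A J \<noteq> {}"
    then obtain E where "{e \<in> E. v \<in> e} = I" "{e \<in> E. v \<in> e} = J" by auto
    with that show False by simp
  qed
  have "{E \<in> ?S. {v, y} \<in> E} = ?A {{v, y}} \<union> ?A {{v, x}, {v, y}}"
  proof (intro equalityI subsetI)
    fix E assume E: "E \<in> {E \<in> ?S. {v, y} \<in> E}"
    then have "{v, y} \<in> {e \<in> E. v \<in> e}" by simp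
    with ne' have "{e \<in> E. v \<in> e} \<noteq> {{v, x}}" by (metis singletonD)
    with cases[of E] E show "E \<in> ?A {{v, y}} \<union> ?A {{v, x}, {v, y}}" by simp
  qed blast
  moreover have "card (?A {{v, y}} \<union> ?A {{v, x}, {v, y}}) =
      card (?A {{v, y}}) + card (?A {{v, x}, {v, y}})"
  proof (rule card_Un_disjoint[OF finA finA disj])
    have "{v, x} \<in> {{v, x}, {v, y}}" "{v, x} \<notin> {{v, y}}" using ne' by simp_all
    then show "{{v, y}} \<noteq> {{v, x}, {v, y}}" by metis
  qed
  ultimately show part: "card {E \<in> ?S. {v, y} \<in> E} = card \<T> + card {E \<in> \<T>. {x, y} \<in> E}"
    using cy cxy by simp
  have "?S = ?A {{v, x}} \<union> {E \<in> ?S. {v, y} \<in> E}"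
  proof (intro equalityI subsetI)
    fix E assume E: "E \<in> ?S"
    from cases[OF this] show "E \<in> ?A {{v, x}} \<union> {E \<in> ?S. {v, y} \<in> E}"
    proof (elim disjE)
      assume "{e \<in> E. v \<in> e} = {{v, y}}"
      then have "{v, y} \<in> {e \<in> E. v \<in> e}" by simp
      with E show ?thesis by simp
    next
      assume "{e \<in> E. v \<in> e} = {{v, x}, {v, y}}"
      then have "{v, y} \<in> {e \<in> E. v \<in> e}" by simp
      with E show ?thesis by simp
    qed (use E in simp)
  qed blast
  moreover have "card (?A {{v, x}} \<union> {E \<in> ?S. {v, y} \<in> E}) =
      card (?A {{v, x}}) + card {E \<in> ?S. {v, y} \<in> E}"
  proof (rule card_Un_disjoint[OF finA])
    show "finite {E \<in> ?S. {v, y} \<in> E}" using finite_spanning_edge_sets[OF fin F] by simp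
    show "?A {{v, x}} \<inter> {E \<in> ?S. {v, y} \<in> E} = {}"
    proof (intro equalityI subsetI)
      fix E assume "E \<in> ?A {{v, x}} \<inter> {E \<in> ?S. {v, y} \<in> E}"
      then have "{v, y} \<in> {e \<in> E. v \<in> e}" "{e \<in> E. v \<in> e} = {{v, x}}" by blast+
      with ne' show "E \<in> {}" by (metis singletonD)
    qed simp
  qed
  ultimately show "card ?S = 2 * card \<T> + card {E \<in> \<T>. {x, y} \<in> E}"
    using cx part by simp
qed

section \<open>Trees are the minimally connecting edge sets\<close>

lemma walk_reach:
  assumes "walk_between \<lparr>sverts = V, sedges = E\<rparr> u p w"
  shows "(u, w) \<in> (adjacency E)\<^sup>*"
proof -
  have "p \<noteq> [] \<Longrightarrow> successively (\<lambda>x y. {x, y} \<in> E) p \<Longrightarrow> (hd p, last p) \<in> (adjacency E)\<^sup>*"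
  proof (induction p rule: induct_list012)
    case (3 x y zs)
    then have "(x, y) \<in> adjacency E" "(y, last (y # zs)) \<in> (adjacency E)\<^sup>*"
      by (auto simp: adjacency_def)
    then show ?case by (auto intro: converse_rtrancl_into_rtrancl)
  qed auto
  with assms show ?thesis by (auto simp: walk_between_def)
qed

text \<open>A walk is shortened whenever it returns to its start, so that every vertex is used at most once;
  distinctness is what makes such a walk part of a cycle.\<close>

lemma reach_distinct_walk:
  assumes "(u, w) \<in> (adjacency E)\<^sup>*" and "w \<in> V" and E: "\<And>e. e \<in> E \<Longrightarrow> e \<subseteq> V"
  shows "\<exists>p. distinct p \<and> walk_between \<lparr>sverts = V, sedges = E\<rparr> u p w"
  using assms(1)
proof (induction rule: converse_rtrancl_induct)
  case base
  have "walk_between \<lparr>sverts = V, sedges = E\<rparr> w [w] w"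
    using \<open>w \<in> V\<close> by (simp add: walk_between_def)
  then show ?case by (intro exI[of _ "[w]"]) simp
next
  case (step y z)
  then obtain p where p: "distinct p" "walk_between \<lparr>sverts = V, sedges = E\<rparr> z p w" by blast
  from step(1) have yz: "{y, z} \<in> E" by (simp add: adjacency_def)
  with E have yV: "y \<in> V" by blast
  show ?case
  proof (cases "y \<in> set p")
    case True
    then obtain as bs where "p = as @ y # bs" by (meson split_list)
    with p have "distinct (y # bs)" "walk_between \<lparr>sverts = V, sedges = E\<rparr> y (y # bs) w"
      by (auto simp: walk_between_def successively_append_iff)
    then show ?thesis by blast
  next
    case False
    with p yz yV have "distinct (y # p)" "walk_between \<lparr>sverts = V, sedges = E\<rparr> y (y # p) w"
      by (auto simp: walk_between_def successively_Cons)
    then show ?thesis by blast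
  qed
qed

text \<open>An edge closes a cycle exactly if its ends stay connected without it, that is, exactly if it can
  be dropped from a connected graph.\<close>

lemma tree_graph_iff_minimally_connects:
  "tree_graph \<lparr>sverts = V, sedges = E\<rparr> \<longleftrightarrow>
     finite V \<and> V \<noteq> {} \<and> simple_edges V E \<and> minimally_connects E V"
proof -
  let ?G = "\<lambda>E. \<lparr>sverts = V, sedges = E\<rparr>"
  have conn: "connected_graph (?G E) \<longleftrightarrow> V \<noteq> {} \<and> connects E V" if "simple_edges V E"
  proof -
    have "(\<exists>p. walk_between (?G E) u p w) \<longleftrightarrow> (u, w) \<in> (adjacency E)\<^sup>*" if "w \<in> V" for u w
      using walk_reach reach_distinct_walk[of u w E V] that \<open>simple_edges V E\<close>
      by (auto simp: simple_edges_def)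
    then show ?thesis by (simp add: connected_graph_def connects_def)
  qed
  have cyc: "(\<exists>c. graph_cycle (?G E) c) \<longleftrightarrow> (\<exists>e\<in>E. connects (E - {e}) V)"
    if s: "simple_edges V E" and c: "connects E V"
  proof
    assume "\<exists>c. graph_cycle (?G E) c"
    then obtain c where c3: "3 \<le> length c" "distinct c" "set c \<subseteq> V"
      "successively (\<lambda>x y. {x, y} \<in> E) c" and e: "{last c, hd c} \<in> E"
      by (auto simp: graph_cycle_def)
    let ?e = "{last c, hd c}"
    \<comment> \<open>The closing edge is not an edge of the walk itself: this is where length 3 is essential.\<close>
    have "{c ! i, c ! Suc i} \<noteq> ?e" if "Suc i < length c" for i
    proof
      have ne: "c \<noteq> []" using that by auto
      assume "{c ! i, c ! Suc i} = ?e"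
      moreover have "last c = c ! (length c - 1)" "hd c = c ! 0"
        using c3(1) last_conv_nth[of c] hd_conv_nth[of c] by fastforce+
      ultimately have "{c ! i, c ! Suc i} = {c ! (length c - 1), c ! 0}" by simp
      then have "i = 0 \<and> Suc i = length c - 1 \<or> i = length c - 1"
        using c3(1,2) that nth_eq_iff_index_eq[of c i 0] ne
        by (auto simp: doubleton_eq_iff nth_eq_iff_index_eq)
      with c3(1) that show False by auto
    qed
    then have "successively (\<lambda>x y. {x, y} \<in> E - {?e}) c"
      using c3(4) by (simp add: successively_conv_nth)
    with c3 have "walk_between (?G (E - {?e})) (hd c) c (last c)"
      by (auto simp: walk_between_def)
    from walk_reach[OF this] have r: "(hd c, last c) \<in> (adjacency (E - {?e}))\<^sup>*" .
    have "connects (E - {?e}) V"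
    proof (rule connects_simulate[OF _ c])
      fix a b assume "{a, b} \<in> E"
      then show "(a, b) \<in> (adjacency (E - {?e}))\<^sup>*"
        using r reach_sym[OF r] edge_reach[of a b "E - {?e}"]
        by (cases "{a, b} = ?e") (auto simp: doubleton_eq_iff)
    qed
    with e show "\<exists>e\<in>E. connects (E - {e}) V" by blast
  next
    assume "\<exists>e\<in>E. connects (E - {e}) V"
    then obtain e where e: "e \<in> E" "connects (E - {e}) V" by blast
    from s e(1) obtain x y where xy: "e = {x, y}" "x \<noteq> y" "x \<in> V" "y \<in> V"
      unfolding simple_edges_def by (metis card_2_iff insert_subset)
    from e(2) xy have "(x, y) \<in> (adjacency (E - {e}))\<^sup>*" by (simp add: connects_def)
    with reach_distinct_walk[of x y "E - {e}" V] xy s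
    obtain p where p: "distinct p" "walk_between (?G (E - {e})) x p y"
      by (auto simp: simple_edges_def)
    \<comment> \<open>A walk on two vertices would have to use the edge \<open>e\<close> that has been dropped.\<close>
    have "3 \<le> length p"
    proof (rule ccontr)
      assume "\<not> 3 \<le> length p"
      with p(2) consider a where "p = [a]" | a b where "p = [a, b]"
        by (cases p rule: remdups_adj.cases) (auto simp: walk_between_def Suc_le_eq)
      then show False using p(2) xy by cases (auto simp: walk_between_def)
    qed
    moreover have "successively (\<lambda>x y. {x, y} \<in> E) p"
      using p(2) by (auto simp: walk_between_def elim: successively_mono)
    ultimately have "graph_cycle (?G E) p"
      using p e(1) xy by (auto simp: graph_cycle_def walk_between_def insert_commute)
    then show "\<exists>c. graph_cycle (?G E) c" by blast
  qed
  show ?thesis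
    using conn cyc unfolding tree_graph_def finite_simple_graph_def minimally_connects_def
    by (auto simp: simple_edges_def)
qed

lemma spanning_trees_eq_image:
  assumes "finite V" "V \<noteq> {}" "simple_edges V F"
  shows "spanning_trees \<lparr>sverts = V, sedges = F\<rparr> =
         (\<lambda>E. \<lparr>sverts = V, sedges = E\<rparr>) ` spanning_edge_sets V F"
proof (intro equalityI subsetI)
  fix T assume T: "T \<in> spanning_trees \<lparr>sverts = V, sedges = F\<rparr>"
  obtain W E where TE: "T = \<lparr>sverts = W, sedges = E\<rparr>" by (cases T) auto
  with T have "W = V" "E \<subseteq> F" "tree_graph \<lparr>sverts = V, sedges = E\<rparr>"
    by (auto simp: spanning_trees_def)
  with TE show "T \<in> (\<lambda>E. \<lparr>sverts = V, sedges = E\<rparr>) ` spanning_edge_sets V F"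
    by (auto simp: spanning_edge_sets_def tree_graph_iff_minimally_connects)
next
  fix T assume "T \<in> (\<lambda>E. \<lparr>sverts = V, sedges = E\<rparr>) ` spanning_edge_sets V F"
  then obtain E where "T = \<lparr>sverts = V, sedges = E\<rparr>" "E \<subseteq> F" "minimally_connects E V"
    by (auto simp: spanning_edge_sets_def)
  moreover from this have "simple_edges V E" using assms(3) by (auto simp: simple_edges_def)
  ultimately show "T \<in> spanning_trees \<lparr>sverts = V, sedges = F\<rparr>"
    using assms by (simp add: spanning_trees_def tree_graph_iff_minimally_connects)
qed

lemma num_spanning_trees_eq:
  assumes "finite V" "V \<noteq> {}" "simple_edges V F"
  shows "num_spanning_trees \<lparr>sverts = V, sedges = F\<rparr> = card (spanning_edge_sets V F)"
  unfolding num_spanning_trees_def spanning_trees_eq_image[OF assms]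
  by (rule card_image) (simp add: inj_on_def)

lemma sum_leaves_eq:
  assumes "finite V" "V \<noteq> {}" "simple_edges V F"
  shows "(\<Sum>T\<in>spanning_trees \<lparr>sverts = V, sedges = F\<rparr>. card (graph_leaves T)) =
         (\<Sum>v\<in>V. card {x. {v, x} \<in> F} *
            card (spanning_edge_sets (V - {v}) (edges_avoiding v F)))"
proof -
  have "(\<Sum>T\<in>spanning_trees \<lparr>sverts = V, sedges = F\<rparr>. card (graph_leaves T)) =
        (\<Sum>E\<in>spanning_edge_sets V F. card {v \<in> V. card {e \<in> E. v \<in> e} = 1})"
    unfolding spanning_trees_eq_image[OF assms]
    by (subst sum.reindex) (auto simp: inj_on_def graph_leaves_def vertex_degree_def)
  then show ?thesis using sum_leaves_over_trees[OF assms(1,3)] by simp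
qed

section \<open>Distances in a path\<close>

lemma graph_dist_le_iff:
  "graph_dist G u v \<le> enat k \<longleftrightarrow> (\<exists>p. walk_between G u p v \<and> length p - 1 \<le> k)"
proof -
  have "graph_dist G u v \<le> enat k \<longleftrightarrow> graph_dist G u v < enat (Suc k)"
    by (cases "graph_dist G u v") auto
  also have "\<dots> \<longleftrightarrow> (\<exists>p. walk_between G u p v \<and> length p - 1 < Suc k)"
    unfolding graph_dist_def INF_less_iff by simp
  finally show ?thesis by (simp add: less_Suc_eq_le)
qed

lemma one_le_graph_dist_iff:
  assumes "u \<in> sverts G"
  shows "1 \<le> graph_dist G u v \<longleftrightarrow> u \<noteq> v"
proof -
  have "graph_dist G u v < 1 \<longleftrightarrow> graph_dist G u v \<le> enat 0"
    by (cases "graph_dist G u v") (auto simp: one_enat_def)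
  also have "\<dots> \<longleftrightarrow> (\<exists>p. walk_between G u p v \<and> length p = 1)"
    unfolding graph_dist_le_iff
    by (metis One_nat_def le_zero_eq diff_is_0_eq le_antisym length_greater_0_conv
        less_eq_Suc_le walk_between_def order_refl)
  also have "\<dots> \<longleftrightarrow> u = v"
  proof
    assume "u = v"
    with assms have "walk_between G u [u] v" by (simp add: walk_between_def)
    then show "\<exists>p. walk_between G u p v \<and> length p = 1" by force
  qed (auto simp: walk_between_def length_Suc_conv)
  finally show ?thesis by (simp add: not_less[symmetric])
qed

lemma path_graph_walk_displacement:
  assumes "walk_between (path_graph n) u p v"
  shows "u \<le> v + (length p - 1) \<and> v \<le> u + (length p - 1)"
proof -
  have "p \<noteq> [] \<Longrightarrow> successively (\<lambda>x y. {x, y} \<in> sedges (path_graph n)) p \<Longrightarrow>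
      hd p \<le> last p + (length p - 1) \<and> last p \<le> hd p + (length p - 1)"
  proof (induction p rule: induct_list012)
    case (3 x y zs)
    then have "x = Suc y \<or> y = Suc x"
      by (auto simp: path_graph_def doubleton_eq_iff)
    with 3 show ?case by auto
  qed auto
  with assms show ?thesis by (auto simp: walk_between_def)
qed

section \<open>The square of a path\<close>

text \<open>On \<open>{..<n}\<close> these are the edges of the square of a path (lemma \<open>path_squares_eq\<close>). The vertex set
  is arbitrary because deleting a vertex from it gives the induced subgraph of the same form.\<close>

definition square_edges :: "nat set \<Rightarrow> nat set set" where
  "square_edges V = {{u, w} | u w. u \<in> V \<and> w \<in> V \<and> u < w \<and> w \<le> u + 2}"

lemma mem_square_edges_iff:
  "{u, w} \<in> square_edges V \<longleftrightarrow> u \<in> V \<and> w \<in> V \<and> u \<noteq> w \<and> u \<le> w + 2 \<and> w \<le> u + 2"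
  by (auto simp: square_edges_def doubleton_eq_iff) (metis linorder_neqE_nat)+

lemma path_graph_dist_le_2_iff:
  assumes "u < n" "v < n"
  shows "graph_dist (path_graph n) u v \<le> enat 2 \<longleftrightarrow> u \<le> v + 2 \<and> v \<le> u + 2"
proof
  assume "graph_dist (path_graph n) u v \<le> enat 2"
  then obtain p where "walk_between (path_graph n) u p v" "length p - 1 \<le> 2"
    unfolding graph_dist_le_iff by blast
  with path_graph_walk_displacement show "u \<le> v + 2 \<and> v \<le> u + 2" by fastforce
next
  assume "u \<le> v + 2 \<and> v \<le> u + 2"
  then consider "u = v" | "v = Suc u" | "v = Suc (Suc u)" | "u = Suc v" | "u = Suc (Suc v)"
    by linarith
  then have "\<exists>p. walk_between (path_graph n) u p v \<and> length p \<le> 3"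
  proof cases
    case 1
    with assms show ?thesis
      by (intro exI[of _ "[u]"]) (auto simp: walk_between_def path_graph_def)
  next
    case 2
    with assms show ?thesis
      by (intro exI[of _ "[u, v]"]) (auto simp: walk_between_def path_graph_def)
  next
    case 3
    with assms show ?thesis
      by (intro exI[of _ "[u, Suc u, v]"]) (auto simp: walk_between_def path_graph_def)
  next
    case 4
    with assms show ?thesis
      by (intro exI[of _ "[u, v]"]) (auto simp: walk_between_def path_graph_def insert_commute)
  next
    case 5
    with assms show ?thesis
      by (intro exI[of _ "[u, Suc v, v]"])
        (auto simp: walk_between_def path_graph_def insert_commute)
  qed
  then show "graph_dist (path_graph n) u v \<le> enat 2"
    unfolding graph_dist_le_iff by fastforce
qed

lemma path_squares_eq: "path_squares n = \<lparr>sverts = {..<n}, sedges = square_edges {..<n}\<rparr>"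
proof -
  have V: "sverts (path_graph n) = {..<n}" by (simp add: path_graph_def)
  have "1 \<le> graph_dist (path_graph n) u v \<and> graph_dist (path_graph n) u v \<le> enat 2 \<longleftrightarrow>
        {u, v} \<in> square_edges {..<n}" if "u < n" "v < n" for u v
    using that one_le_graph_dist_iff[of u "path_graph n" v] path_graph_dist_le_2_iff[OF that]
    by (auto simp: V mem_square_edges_iff)
  then have "{{u, v} | u v. u \<in> {..<n} \<and> v \<in> {..<n} \<and>
        1 \<le> graph_dist (path_graph n) u v \<and> graph_dist (path_graph n) u v \<le> enat 2} =
      {{u, v} | u v. u \<in> {..<n} \<and> v \<in> {..<n} \<and> {u, v} \<in> square_edges {..<n}}"
    unfolding lessThan_iff by (intro Collect_cong) blast
  also have "\<dots> = square_edges {..<n}" by (auto simp: square_edges_def)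
  finally show ?thesis by (simp add: path_squares_def graph_power_def V)
qed

abbreviation square_trees :: "nat set \<Rightarrow> nat set set set" where
  "square_trees V \<equiv> spanning_edge_sets V (square_edges V)"

lemma simple_square_edges: "simple_edges V (square_edges V)"
  by (auto simp: simple_edges_def square_edges_def)

lemma edges_avoiding_square_edges: "edges_avoiding v (square_edges V) = square_edges (V - {v})"
  by (auto simp: edges_avoiding_def square_edges_def)

lemma square_edges_incident:
  assumes "v \<in> V"
  shows "{e \<in> square_edges V. v \<in> e} = (\<lambda>w. {v, w}) ` {w \<in> V. w \<noteq> v \<and> v \<le> w + 2 \<and> w \<le> v + 2}"
proof (intro equalityI subsetI)
  fix e assume e: "e \<in> {e \<in> square_edges V. v \<in> e}"
  then obtain w where "e = {v, w}" using simple_edges_incident[OF simple_square_edges] by blast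
  with e show "e \<in> (\<lambda>w. {v, w}) ` {w \<in> V. w \<noteq> v \<and> v \<le> w + 2 \<and> w \<le> v + 2}"
    by (auto simp: mem_square_edges_iff)
qed (use assms in \<open>auto simp: mem_square_edges_iff\<close>)

lemma square_trees_singleton: "square_trees {s} = {{}}"
proof -
  have "square_edges {s} = {}" by (auto simp: square_edges_def)
  then show ?thesis by (auto simp: spanning_edge_sets_def minimally_connects_def connects_def)
qed

text \<open>The block \<open>s, s + 1, ...\<close> touches the old vertices \<open>U\<close> only through \<open>s\<close>: among the
  vertices before it, \<open>s + 1\<close> is adjacent to \<open>s\<close> alone and every later one to exactly its two
  predecessors. So the count starts
  from the graph on \<open>insert s U\<close> and then follows the Fibonacci recurrence. The second conjunct
  counts the trees through the last edge of the block, which the recurrence needs.\<close>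

lemma card_square_trees_append_block:
  assumes fin: "finite U" and far: "\<And>u. u \<in> U \<Longrightarrow> u + 2 \<le> s"
  shows "card (square_trees (U \<union> {s..<s + k + 2})) =
           card (square_trees (insert s U)) * fib (2 * k + 2) \<and>
         card {E \<in> square_trees (U \<union> {s..<s + k + 2}). {s + k, s + k + 1} \<in> E} =
           card (square_trees (insert s U)) * fib (2 * k + 1)"
proof (induction k)
  case 0
  let ?V = "insert (Suc s) (insert s U)"
  have V: "U \<union> {s..<s + 0 + 2} = ?V" by auto
  have del: "?V - {Suc s} = insert s U" using far by force
  have "{w \<in> ?V. w \<noteq> Suc s \<and> Suc s \<le> w + 2 \<and> w \<le> Suc s + 2} = {s}"
    using far by fastforce
  then have inc: "{e \<in> square_edges ?V. Suc s \<in> e} = {{Suc s, s}}"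
    by (subst square_edges_incident) auto
  have "card (square_trees ?V) = card (square_trees (insert s U))"
    using card_trees_pendant(1)[OF simple_square_edges _ inc]
    by (simp add: edges_avoiding_square_edges del)
  moreover have "{E \<in> square_trees ?V. {s, Suc s} \<in> E} = square_trees ?V"
    using card_trees_pendant(2)[OF simple_square_edges _ inc] by (simp add: insert_commute)
  ultimately show ?case unfolding V by simp
next
  case (Suc k)
  let ?z = "s + k + 2" and ?x = "s + k" and ?y = "s + k + 1"
  let ?V = "U \<union> {s..<s + k + 3}" and ?W = "U \<union> {s..<s + k + 2}"
  have z: "?z \<in> ?V" by simp
  have del: "?V - {?z} = ?W" using far by force
  have "{w \<in> ?V. w \<noteq> ?z \<and> ?z \<le> w + 2 \<and> w \<le> ?z + 2} = {?x, ?y}"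
    using far by fastforce
  then have inc: "{e \<in> square_edges ?V. ?z \<in> e} = {{?z, ?x}, {?z, ?y}}"
    by (subst square_edges_incident) auto
  have xy: "{?x, ?y} \<in> square_edges ?V" by (simp add: mem_square_edges_iff)
  have "finite ?V" using fin by simp
  from card_trees_triangle_tip[OF this simple_square_edges z inc xy]
  have "card (square_trees ?V) = 2 * card (square_trees ?W) + card {E \<in> square_trees ?W. {?x, ?y} \<in> E}"
    "card {E \<in> square_trees ?V. {?z, ?y} \<in> E} =
       card (square_trees ?W) + card {E \<in> square_trees ?W. {?x, ?y} \<in> E}"
    unfolding edges_avoiding_square_edges del by auto
  moreover have "fib (2 * Suc k + 2) = 2 * fib (2 * k + 2) + fib (2 * k + 1)"
    "fib (2 * Suc k + 1) = fib (2 * k + 2) + fib (2 * k + 1)" by (simp_all add: numeral_eq_Suc)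
  moreover have "s + Suc k + 2 = s + k + 3" "s + Suc k + 1 = ?z" "s + Suc k = ?y" by simp_all
  ultimately show ?case using Suc.IH
    by (simp only: insert_commute[of ?y ?z]) (simp add: algebra_simps)
qed

text \<open>The number of spanning trees of the square of the path on \<open>n \<ge> 1\<close> vertices. The Fibonacci formula
  fails for one vertex, where it would give 0. The value 1 at 0 makes the product formula of
  \<open>card_square_trees_path_delete\<close> hold for the two end vertices as well.\<close>

definition square_tree_count :: "nat \<Rightarrow> nat" where
  "square_tree_count n = (if n \<le> 1 then 1 else fib (2 * n - 2))"

lemma card_square_trees_append:
  assumes "finite U" "\<And>u. u \<in> U \<Longrightarrow> u + 2 \<le> s" "b \<ge> 1"
  shows "card (square_trees (U \<union> {s..<s + b})) = card (square_trees (insert s U)) * square_tree_count b"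
proof (cases "b = 1")
  case True
  then show ?thesis by (simp add: square_tree_count_def)
next
  case False
  with assms(3) have "b = (b - 2) + 2" by simp
  then obtain k where k: "b = k + 2" by blast
  then have "s + b = s + k + 2" "square_tree_count b = fib (2 * k + 2)"
    by (auto simp: square_tree_count_def)
  then show ?thesis using card_square_trees_append_block[OF assms(1,2), of k] by simp
qed

lemma card_square_trees_path:
  assumes "n \<ge> 1"
  shows "card (square_trees {..<n}) = square_tree_count n"
  using card_square_trees_append[of "{}" 0 n] assms
  by (simp add: square_trees_singleton lessThan_atLeast0)

text \<open>If \<open>v\<close> is not an end vertex, \<open>v + 1\<close> hangs on the left part by the single edge \<open>{v - 1, v + 1}\<close>, and
  the block of vertices from \<open>v + 1\<close> on is attached as in \<open>card_square_trees_append\<close>.\<close>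

lemma card_square_trees_path_delete:
  assumes "n \<ge> 2" "v < n"
  shows "card (square_trees ({..<n} - {v})) = square_tree_count v * square_tree_count (n - 1 - v)"
proof -
  have base: "card (square_trees (insert (Suc v) {..<v})) = square_tree_count v"
  proof (cases "v = 0")
    case True
    then show ?thesis by (simp add: square_trees_singleton square_tree_count_def)
  next
    case False
    let ?V = "insert (Suc v) {..<v}"
    have "{w \<in> ?V. w \<noteq> Suc v \<and> Suc v \<le> w + 2 \<and> w \<le> Suc v + 2} = {v - 1}"
      using False by auto
    then have inc: "{e \<in> square_edges ?V. Suc v \<in> e} = {{Suc v, v - 1}}"
      by (subst square_edges_incident) auto
    have del: "?V - {Suc v} = {..<v}" by auto
    show ?thesis
      using card_trees_pendant(1)[OF simple_square_edges _ inc] card_square_trees_path[of v] False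
      by (simp add: edges_avoiding_square_edges del)
  qed
  show ?thesis
  proof (cases "v = n - 1")
    case True
    then have "{..<n} - {v} = {..<v}" using assms by auto
    moreover have "v \<ge> 1" "n - 1 - v = 0" using True assms by auto
    moreover have "square_tree_count 0 = 1" by (simp add: square_tree_count_def)
    ultimately show ?thesis using card_square_trees_path[of v] by simp
  next
    case False
    then have "{..<n} - {v} = {..<v} \<union> {Suc v..<Suc v + (n - 1 - v)}" using assms by auto
    then show ?thesis
      using card_square_trees_append[of "{..<v}" "Suc v" "n - 1 - v"] base False assms by simp
  qed
qed

lemma card_square_neighbours:
  assumes "v < n"
  shows "card {x. {v, x} \<in> square_edges {..<n}} = min 2 v + min 2 (n - 1 - v)"
proof -
  have "{x. {v, x} \<in> square_edges {..<n}} = {v - min 2 v..<v} \<union> {v + 1..<v + 1 + min 2 (n - 1 - v)}"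
    using assms by (auto simp: mem_square_edges_iff min_def)
  then show ?thesis by (simp add: card_Un_disjoint)
qed

lemma num_spanning_trees_path_squares:
  "n \<ge> 1 \<Longrightarrow> num_spanning_trees (path_squares n) = square_tree_count n"
  unfolding path_squares_eq
  by (subst num_spanning_trees_eq) (auto simp: simple_square_edges card_square_trees_path lessThan_empty_iff)

lemma sum_leaves_path_squares:
  assumes "n \<ge> 2"
  shows "(\<Sum>T\<in>spanning_trees (path_squares n). card (graph_leaves T)) =
    (\<Sum>v<n. (min 2 v + min 2 (n - 1 - v)) * (square_tree_count v * square_tree_count (n - 1 - v)))"
  unfolding path_squares_eq
  using assms
  by (subst sum_leaves_eq)
     (auto simp: simple_square_edges edges_avoiding_square_edges card_square_neighbours
        card_square_trees_path_delete lessThan_empty_iff intro!: sum.cong)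

text \<open>The two vertices at each end have degrees 2 and 3 and are split off; all others have degree 4. The
  shift by 5 makes these four vertices distinct and keeps at least one vertex of degree 4.\<close>

lemma sum_leaves_path_squares_split:
  "(\<Sum>T\<in>spanning_trees (path_squares (k + 5)). card (graph_leaves T)) =
    4 * fib (2 * k + 6) + 6 * fib (2 * k + 4) +
    4 * (\<Sum>j\<le>k. fib (2 * j + 2) * fib (2 * (k - j) + 2))"
proof -
  let ?t = square_tree_count
  define f where "f v = (min 2 v + min 2 (k + 4 - v)) * (?t v * ?t (k + 4 - v))" for v
  have "(\<Sum>T\<in>spanning_trees (path_squares (k + 5)). card (graph_leaves T)) = (\<Sum>v<k + 5. f v)"
    by (subst sum_leaves_path_squares) (simp_all add: f_def add.commute)
  also have "\<dots> = (\<Sum>v<k + 3. f v) + f (k + 3) + f (k + 4)"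
    by (simp add: eval_nat_numeral)
  also have "(\<Sum>v<k + 3. f v) = f 0 + f 1 + (\<Sum>j\<le>k. f (j + 2))"
    by (simp add: eval_nat_numeral sum.lessThan_Suc_shift lessThan_Suc_atMost[symmetric]
        del: sum.lessThan_Suc)
  finally have total: "(\<Sum>T\<in>spanning_trees (path_squares (k + 5)). card (graph_leaves T)) =
    f 0 + f 1 + (\<Sum>j\<le>k. f (j + 2)) + f (k + 3) + f (k + 4)" .
  have ends: "f 0 = 2 * fib (2 * k + 6)" "f 1 = 3 * fib (2 * k + 4)"
    "f (k + 3) = 3 * fib (2 * k + 4)" "f (k + 4) = 2 * fib (2 * k + 6)"
    by (simp_all add: f_def square_tree_count_def add.commute)
  have "(\<Sum>j\<le>k. f (j + 2)) = (\<Sum>j\<le>k. 4 * (fib (2 * j + 2) * fib (2 * (k - j) + 2)))"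
  proof (rule sum.cong[OF refl])
    fix j assume "j \<in> {..k}"
    then have "k + 4 - (j + 2) = (k - j) + 2" by simp
    then show "f (j + 2) = 4 * (fib (2 * j + 2) * fib (2 * (k - j) + 2))"
      unfolding f_def by (simp add: square_tree_count_def)
  qed
  then show ?thesis unfolding total ends by (simp add: sum_distrib_left)
qed

section \<open>Asymptotics\<close>

lemma real_fib_even:
  "real (fib (2 * n)) = (((3 + sqrt 5) / 2) ^ n - ((3 - sqrt 5) / 2) ^ n) / sqrt 5"
proof -
  have "((1 + sqrt 5) / 2)\<^sup>2 = (3 + sqrt 5) / 2" "((1 - sqrt 5) / 2)\<^sup>2 = (3 - sqrt 5) / 2"
    by (simp_all add: power2_eq_square field_simps)
  then show ?thesis using fib_closed_form[of "2 * n"] by (simp only: power_mult)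
qed

text \<open>By the closed form, five times each summand is the constant \<open>\<alpha>\<^bsup>k+2\<^esup> + \<beta>\<^bsup>k+2\<^esup>\<close> minus two
  mixed products. As \<open>\<alpha> \<beta> = 1\<close>, the mixed products sum to geometric sums, which are Fibonacci numbers
  again, hence of lower order than the first part.\<close>

lemma convolution_fib_even:
  fixes \<alpha> \<beta> :: real
  defines "\<alpha> \<equiv> (3 + sqrt 5) / 2" and "\<beta> \<equiv> (3 - sqrt 5) / 2"
  shows "5 * real (\<Sum>j\<le>k. fib (2 * j + 2) * fib (2 * (k - j) + 2)) =
    (real k + 1) * (\<alpha> ^ (k + 2) + \<beta> ^ (k + 2)) - 2 * real (fib (2 * k + 2))"
proof -
  have ab: "\<alpha> * \<beta> = 1" by (simp add: \<alpha>_def \<beta>_def field_simps)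
  have diff: "\<alpha> - \<beta> = sqrt 5" by (simp add: \<alpha>_def \<beta>_def field_simps)
  have fib: "real (fib (2 * n + 2)) = (\<alpha> ^ Suc n - \<beta> ^ Suc n) / sqrt 5" for n
    using real_fib_even[of "Suc n"] by (simp add: \<alpha>_def \<beta>_def)
  have "5 * (real (fib (2 * j + 2)) * real (fib (2 * (k - j) + 2))) =
      \<alpha> ^ (k + 2) + \<beta> ^ (k + 2) - \<alpha> ^ j * \<beta> ^ (k - j) - \<beta> ^ j * \<alpha> ^ (k - j)" if "j \<le> k" for j
  proof -
    have "5 * (real (fib (2 * j + 2)) * real (fib (2 * (k - j) + 2))) =
        (\<alpha> ^ Suc j - \<beta> ^ Suc j) * (\<alpha> ^ Suc (k - j) - \<beta> ^ Suc (k - j))"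
      unfolding fib by simp
    also have "\<dots> = \<alpha> ^ (Suc j + Suc (k - j)) + \<beta> ^ (Suc j + Suc (k - j))
        - (\<alpha> * \<beta>) * (\<alpha> ^ j * \<beta> ^ (k - j)) - (\<alpha> * \<beta>) * (\<beta> ^ j * \<alpha> ^ (k - j))"
      unfolding power_add by (simp add: algebra_simps)
    also have "Suc j + Suc (k - j) = k + 2" using that by simp
    finally show ?thesis by (simp add: ab)
  qed
  then have "5 * real (\<Sum>j\<le>k. fib (2 * j + 2) * fib (2 * (k - j) + 2)) =
      (\<Sum>j\<le>k. \<alpha> ^ (k + 2) + \<beta> ^ (k + 2) - \<alpha> ^ j * \<beta> ^ (k - j) - \<beta> ^ j * \<alpha> ^ (k - j))"
    by (simp add: sum_distrib_left)
  also have "\<dots> = (real k + 1) * (\<alpha> ^ (k + 2) + \<beta> ^ (k + 2))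
      - (\<Sum>j\<le>k. \<alpha> ^ j * \<beta> ^ (k - j)) - (\<Sum>j\<le>k. \<beta> ^ j * \<alpha> ^ (k - j))"
    by (simp add: sum_subtractf sum.distrib algebra_simps)
  also have "(\<Sum>j\<le>k. \<alpha> ^ j * \<beta> ^ (k - j)) = real (fib (2 * k + 2))"
    using diff_power_eq_sum[of \<alpha> k \<beta>] unfolding fib diff by (simp add: lessThan_Suc_atMost)
  also have "(\<Sum>j\<le>k. \<beta> ^ j * \<alpha> ^ (k - j)) = real (fib (2 * k + 2))"
  proof -
    have neg: "\<beta> - \<alpha> = - sqrt 5" using diff by simp
    have "\<beta> ^ Suc k - \<alpha> ^ Suc k = - sqrt 5 * (\<Sum>j\<le>k. \<beta> ^ j * \<alpha> ^ (k - j))"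
      using diff_power_eq_sum[of \<beta> k \<alpha>] unfolding neg lessThan_Suc_atMost .
    then have "\<alpha> ^ Suc k - \<beta> ^ Suc k = sqrt 5 * (\<Sum>j\<le>k. \<beta> ^ j * \<alpha> ^ (k - j))" by linarith
    then show ?thesis unfolding fib by simp
  qed
  finally show ?thesis by simp
qed

text \<open>The boundary terms and the lower-order part of the convolution are bounded after division by \<open>\<alpha>\<^sup>k\<close>,
  so division by the number \<open>n = k + 5\<close> of vertices makes them vanish. Only the \<open>k + 1\<close> equal main
  terms of the convolution contribute to the limit.\<close>

lemma tendsto_BZ_ratio_path_squares:
  "BZ_ratio path_squares \<longlonglongrightarrow> - 6 + 14 * sqrt 5 / 5"
proof -
  define \<alpha> :: real where "\<alpha> = (3 + sqrt 5) / 2"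
  define \<beta> :: real where "\<beta> = (3 - sqrt 5) / 2"
  define r where "r = \<beta> / \<alpha>"
  have pos: "\<alpha> > 0" by (simp add: \<alpha>_def add_pos_pos)
  have sqrt5: "2 < sqrt 5" "sqrt 5 < 3" by (simp_all add: real_less_rsqrt real_less_lsqrt)
  have r: "0 < r" "r < 1" using pos sqrt5 by (simp_all add: r_def \<alpha>_def \<beta>_def field_simps)
  have rk: "(\<lambda>k. r ^ k) \<longlonglongrightarrow> 0" using r by (intro LIMSEQ_power_zero) simp
  have \<beta>_pow: "\<beta> ^ k = r ^ k * \<alpha> ^ k" for k
    using pos by (simp add: r_def power_divide)
  \<comment> \<open>\<open>g i k\<close> is \<open>F\<^bsub>2(k+i)\<^esub> / \<alpha>\<^sup>k\<close>; this scaling cancels in the ratio and makes all terms converge.\<close>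
  define g where "g i k = (\<alpha> ^ i - \<beta> ^ i * r ^ k) / sqrt 5" for i k :: nat
  have fib: "real (fib (2 * k + 2 * i)) = g i k * \<alpha> ^ k" for i k
    using real_fib_even[of "k + i"]
    by (simp add: \<alpha>_def[symmetric] \<beta>_def[symmetric] g_def \<beta>_pow[of k] power_add algebra_simps)
  have g: "(\<lambda>k. g i k) \<longlonglongrightarrow> \<alpha> ^ i / sqrt 5" for i
  proof -
    have "(\<lambda>k. g i k) \<longlonglongrightarrow> (\<alpha> ^ i - \<beta> ^ i * 0) / sqrt 5"
      unfolding g_def by (intro tendsto_intros rk) simp
    then show ?thesis by simp
  qed
  have ratio: "BZ_ratio path_squares (k + 5) =
      ((4 * g 3 k + 6 * g 2 k - 8 / 5 * g 1 k) / (real k + 5) +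
       4 / 5 * ((real k + 1) / (real k + 5)) * (\<alpha>\<^sup>2 + \<beta>\<^sup>2 * r ^ k)) / g 4 k" for k
  proof -
    define S where "S = (\<Sum>j\<le>k. fib (2 * j + 2) * fib (2 * (k - j) + 2))"
    have "5 * real S = (real k + 1) * (\<alpha> ^ (k + 2) + \<beta> ^ (k + 2)) - 2 * real (fib (2 * k + 2))"
      unfolding S_def \<alpha>_def \<beta>_def by (rule convolution_fib_even)
    also have "real (fib (2 * k + 2)) = g 1 k * \<alpha> ^ k" using fib[of k 1] by simp
    finally have conv: "real S = ((real k + 1) * (\<alpha>\<^sup>2 + \<beta>\<^sup>2 * r ^ k) - 2 * g 1 k) * \<alpha> ^ k / 5"
      unfolding power_add \<beta>_pow[of k] by (simp add: algebra_simps)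
    have "real (\<Sum>T\<in>spanning_trees (path_squares (k + 5)). card (graph_leaves T)) =
        4 * real (fib (2 * k + 6)) + 6 * real (fib (2 * k + 4)) + 4 * real S"
      unfolding sum_leaves_path_squares_split S_def by simp
    also have "\<dots> = (4 * g 3 k + 6 * g 2 k - 8 / 5 * g 1 k +
        4 / 5 * (real k + 1) * (\<alpha>\<^sup>2 + \<beta>\<^sup>2 * r ^ k)) * \<alpha> ^ k"
      using fib[of k 3] fib[of k 2] unfolding conv by (simp add: field_simps)
    finally have num: "real (\<Sum>T\<in>spanning_trees (path_squares (k + 5)). card (graph_leaves T)) =
        (4 * g 3 k + 6 * g 2 k - 8 / 5 * g 1 k +
        4 / 5 * (real k + 1) * (\<alpha>\<^sup>2 + \<beta>\<^sup>2 * r ^ k)) * \<alpha> ^ k" .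
    have "num_spanning_trees (path_squares (k + 5)) = fib (2 * k + 2 * 4)"
      by (simp add: num_spanning_trees_path_squares square_tree_count_def add.commute)
    then have den: "real (num_spanning_trees (path_squares (k + 5))) = g 4 k * \<alpha> ^ k"
      using fib[of k 4] by simp
    have "x * \<alpha> ^ k / ((real k + 5) * (y * \<alpha> ^ k)) = x / (real k + 5) / y" for x y
      using pos by simp
    then have "BZ_ratio path_squares (k + 5) = (4 * g 3 k + 6 * g 2 k - 8 / 5 * g 1 k +
        4 / 5 * (real k + 1) * (\<alpha>\<^sup>2 + \<beta>\<^sup>2 * r ^ k)) / (real k + 5) / g 4 k"
      unfolding BZ_ratio_def num den by simp
    also have "(a + 4 / 5 * c * x) / m = a / m + 4 / 5 * (c / m) * x" for a c x m :: real
      by (simp add: add_divide_distrib)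
    finally show ?thesis .
  qed
  have inv: "(\<lambda>k. 1 / (real k + 5)) \<longlonglongrightarrow> 0"
    using LIMSEQ_ignore_initial_segment[OF lim_1_over_n, of 5] by simp
  have quot: "(\<lambda>k. (real k + 1) / (real k + 5)) \<longlonglongrightarrow> 1"
  proof -
    have eq: "(real k + 1) / (real k + 5) = 1 - 4 * (1 / (real k + 5))" for k
      by (simp add: field_simps)
    have "(\<lambda>k. 1 - 4 * (1 / (real k + 5))) \<longlonglongrightarrow> 1 - 4 * 0" by (intro tendsto_intros inv)
    then show ?thesis unfolding eq by simp
  qed
  have "(\<lambda>k. (4 * g 3 k + 6 * g 2 k - 8 / 5 * g 1 k) * (1 / (real k + 5))) \<longlonglongrightarrow>
      (4 * (\<alpha> ^ 3 / sqrt 5) + 6 * (\<alpha> ^ 2 / sqrt 5) - 8 / 5 * (\<alpha> ^ 1 / sqrt 5)) * 0"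
    by (intro tendsto_intros g inv)
  moreover have "(\<lambda>k. 4 / 5 * ((real k + 1) / (real k + 5)) * (\<alpha>\<^sup>2 + \<beta>\<^sup>2 * r ^ k)) \<longlonglongrightarrow>
      4 / 5 * 1 * (\<alpha>\<^sup>2 + \<beta>\<^sup>2 * 0)"
    by (intro tendsto_intros quot rk)
  ultimately have "(\<lambda>k. BZ_ratio path_squares (k + 5)) \<longlonglongrightarrow>
      ((4 * (\<alpha> ^ 3 / sqrt 5) + 6 * (\<alpha> ^ 2 / sqrt 5) - 8 / 5 * (\<alpha> ^ 1 / sqrt 5)) * 0 +
       4 / 5 * 1 * (\<alpha>\<^sup>2 + \<beta>\<^sup>2 * 0)) / (\<alpha> ^ 4 / sqrt 5)"
    unfolding ratio using pos g[of 4]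
    by (intro tendsto_divide tendsto_add) simp_all
  also have "((4 * (\<alpha> ^ 3 / sqrt 5) + 6 * (\<alpha> ^ 2 / sqrt 5) - 8 / 5 * (\<alpha> ^ 1 / sqrt 5)) * 0 +
       4 / 5 * 1 * (\<alpha>\<^sup>2 + \<beta>\<^sup>2 * 0)) / (\<alpha> ^ 4 / sqrt 5) = 4 / 5 * sqrt 5 * (1 / \<alpha>\<^sup>2)"
    using pos by (simp add: field_simps power2_eq_square power4_eq_xxxx)
  also have "1 / \<alpha>\<^sup>2 = (7 - 3 * sqrt 5) / 2"
  proof -
    have "\<alpha>\<^sup>2 = (7 + 3 * sqrt 5) / 2" by (simp add: \<alpha>_def power2_eq_square field_simps)
    moreover have "(7 + 3 * sqrt 5) / 2 * ((7 - 3 * sqrt 5) / 2) = 1" by (simp add: field_simps)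
    ultimately have "\<alpha>\<^sup>2 * ((7 - 3 * sqrt 5) / 2) = 1" by (simp only:)
    then have "inverse (\<alpha>\<^sup>2) = (7 - 3 * sqrt 5) / 2" by (rule inverse_unique)
    then show ?thesis by (simp only: inverse_eq_divide)
  qed
  also have "4 / 5 * sqrt 5 * ((7 - 3 * sqrt 5) / 2) = - 6 + 14 * sqrt 5 / 5"
    by (simp add: field_simps)
  finally show ?thesis by (rule LIMSEQ_offset)
qed

theorem theorem6p3p1:
  shows "convergent (BZ_ratio path_squares) \<and>
         BZ path_squares = - 6 + 14 * sqrt 5 / 5"
  using tendsto_BZ_ratio_path_squares
  unfolding BZ_def by (auto simp: convergent_def dest: limI)

end
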